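(* Let $H=(V,E,\{r_e\})$ be a hypergraph with maximum hyperedge size $k$, where each $r_e\colon\{0,\dots,|e|\}\to\mathbb{R}_{\ge 0}$ is monotone nondecreasing with $r_e(0)=0$. For each $e\in E$ let $s_e$ be a function satisfying $0 \leq s_e(i) \leq r_e(i)$ and $r_e(i) - s_e(i-1) \leq r_e(i+1) - s_e(i)$ (for all $i$ where these quantities are defined). Then the peeling algorithm below, run with these $s_e$, returns a set $Y$ with $\Gamma(Y) \geq \frac{1}{k}\max_{\emptyset\ne S\subseteq V}\Gamma(S)$. Peeling algorithm: set $X\leftarrow V$ and $Y\leftarrow V$. While $X\neq\emptyset$: choose $v\in\arg\min_{u\in X}\sum_{e\in E:\, u\in e}\big(r_e(|e\cap X|)-s_e(|e\cap X|-1)\big)$; set $X\leftarrow X\setminus\{v\}$; if $\Gamma(X)\ge\Gamma(Y)$, set $Y\leftarrow X$. Output $Y$.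
   Context: For a nonempty $S\subseteq V$, $f(S)=\sum_{e\in E} r_e(|e\cap S|)$ and $\Gamma(S)=f(S)/|S|$ (all edge weights are $1$; weights can be absorbed into the rewards). The problem (\textsc{swamp}) is to find a nonempty $S\subseteq V$ maximizing $\Gamma(S)$. *)

theory Defs
  imports Complex_Main
begin

definition total_reward :: "'v set set \<Rightarrow> ('v set \<Rightarrow> nat \<Rightarrow> real) \<Rightarrow> 'v set \<Rightarrow> real" where
  "total_reward E r S = (\<Sum>e\<in>E. r e (card (e \<inter> S)))"

definition density :: "'v set set \<Rightarrow> ('v set \<Rightarrow> nat \<Rightarrow> real) \<Rightarrow> 'v set \<Rightarrow> real" where
  "density E r S = total_reward E r S / real (card S)"

text \<open>Edgeless hypergraphs get size 0.\<close>

definition max_edge_size :: "'v set set \<Rightarrow> nat" where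
  "max_edge_size E = Max (insert 0 (card ` E))"

text \<open>Only evaluated at \<open>u \<in> X\<close>, so \<open>card (e \<inter> X) \<ge> 1\<close> in every summand and the
  subtraction on naturals does not truncate.\<close>

definition peel_cost ::
  "'v set set \<Rightarrow> ('v set \<Rightarrow> nat \<Rightarrow> real) \<Rightarrow> ('v set \<Rightarrow> nat \<Rightarrow> real) \<Rightarrow> 'v set \<Rightarrow> 'v \<Rightarrow> real" where
  "peel_cost E r s X u =
     (\<Sum>e\<in>{e \<in> E. u \<in> e}. r e (card (e \<inter> X)) - s e (card (e \<inter> X) - 1))"

text \<open>\<open>peel E r s X Y Z\<close>: the loop, entered with current set \<open>X\<close> and incumbent \<open>Y\<close>, can
  terminate with output \<open>Z\<close>. It is a relation because ties in the arg-min are broken arbitrarily.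
  The density of the empty set is undefined (in HOL it would be \<open>0 / 0 = 0\<close>), so the empty set
  never replaces the incumbent.\<close>

inductive peel ::
  "'v set set \<Rightarrow> ('v set \<Rightarrow> nat \<Rightarrow> real) \<Rightarrow> ('v set \<Rightarrow> nat \<Rightarrow> real) \<Rightarrow>
     'v set \<Rightarrow> 'v set \<Rightarrow> 'v set \<Rightarrow> bool"
  for E r s where
  stop: "peel E r s {} Y Y"
| step: "is_arg_min (peel_cost E r s X) (\<lambda>u. u \<in> X) v \<Longrightarrow>
    X' = X - {v} \<Longrightarrow>
    Y' = (if X' \<noteq> {} \<and> density E r X' \<ge> density E r Y then X' else Y) \<Longrightarrow>
    peel E r s X' Y' Z \<Longrightarrow>
    peel E r s X Y Z"

definition peeling_returns ::
  "'v set \<Rightarrow> 'v set set \<Rightarrow> ('v set \<Rightarrow> nat \<Rightarrow> real) \<Rightarrow> ('v set \<Rightarrow> nat \<Rightarrow> real) \<Rightarrow> 'v set \<Rightarrow> bool" where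
  "peeling_returns V E r s Y \<longleftrightarrow> peel E r s V V Y"

end

theory Submission
  imports Defs
begin

text \<open>
  Let \<open>S\<close> be a densest set, of density \<open>d\<close>, and let \<open>v\<close> be the first vertex of \<open>S\<close> that is
  peeled, from a set \<open>X \<supseteq> S\<close> say. Optimality of \<open>S\<close> forces its marginal loss
  \<open>f(S) - f(S - {v})\<close> to be at least \<open>d\<close>; as \<open>s\<^sub>e \<le> r\<^sub>e\<close>, the peeling cost of \<open>v\<close> in \<open>S\<close> is at least this
  loss, and the growth condition on \<open>r\<^sub>e(i) - s\<^sub>e(i - 1)\<close> carries the bound from \<open>S\<close> to \<open>X\<close>. Since \<open>v\<close> has
  minimum cost, every vertex of \<open>X\<close> costs at least \<open>d\<close>. Summing over \<open>X\<close>, an edge is counted at most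
  \<open>k\<close> times and, as \<open>s\<^sub>e \<ge> 0\<close>, contributes at most its reward each time, so \<open>d |X| \<le> k f(X)\<close>.
\<close>

locale surrogate_hypergraph =
  fixes V :: "'v set" and E :: "'v set set"
    and r s :: "'v set \<Rightarrow> nat \<Rightarrow> real"
  assumes finite_V: "finite V"
    and edge_subset: "e \<in> E \<Longrightarrow> e \<subseteq> V"
    and reward_0: "e \<in> E \<Longrightarrow> r e 0 = 0"
    and surrogate_nonneg: "e \<in> E \<Longrightarrow> i \<le> card e \<Longrightarrow> 0 \<le> s e i"
    and surrogate_le: "e \<in> E \<Longrightarrow> i \<le> card e \<Longrightarrow> s e i \<le> r e i"
    and gap_step: "e \<in> E \<Longrightarrow> 1 \<le> i \<Longrightarrow> i + 1 \<le> card e \<Longrightarrow>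
           r e i - s e (i - 1) \<le> r e (i + 1) - s e i"
begin

section \<open>Finiteness, nonnegativity and densities\<close>

lemma finite_E: "finite E"
  using finite_V edge_subset by (meson finite_Pow_iff finite_subset PowI subsetI)

lemma finite_edge: "e \<in> E \<Longrightarrow> finite e"
  using finite_V edge_subset by (meson finite_subset)

lemma card_edge_Int_le: "e \<in> E \<Longrightarrow> card (e \<inter> X) \<le> card e"
  by (simp add: card_mono finite_edge)

lemma card_edge_le_max: "e \<in> E \<Longrightarrow> card e \<le> max_edge_size E"
  unfolding max_edge_size_def by (rule Max_ge) (auto simp: finite_E)

lemma reward_nonneg: "e \<in> E \<Longrightarrow> i \<le> card e \<Longrightarrow> 0 \<le> r e i"
  using surrogate_nonneg surrogate_le by (meson order_trans)

lemma total_reward_nonneg: "0 \<le> total_reward E r S"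
  unfolding total_reward_def by (intro sum_nonneg reward_nonneg card_edge_Int_le)

lemma density_nonneg: "0 \<le> density E r S"
  unfolding density_def by (simp add: total_reward_nonneg)

lemma total_reward_empty: "total_reward E r {} = 0"
  unfolding total_reward_def by (simp add: reward_0)

lemma total_reward_eq_density:
  assumes "S \<subseteq> V"
  shows "total_reward E r S = density E r S * real (card S)"
proof (cases "S = {}")
  case False
  then have "card S > 0" using assms finite_V by (simp add: card_gt_0_iff finite_subset)
  then show ?thesis by (simp add: density_def)
qed (simp add: total_reward_empty)

section \<open>Bounds on the peeling cost\<close>

lemma gap_mono:
  assumes "e \<in> E" "1 \<le> i" "i \<le> j" "j \<le> card e"
  shows "r e i - s e (i - 1) \<le> r e j - s e (j - 1)"
  using assms(3,4)
proof (induction j rule: dec_induct)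
  case (step n)
  then show ?case using gap_step[OF assms(1), of n] assms(2) by simp
qed simp

text \<open>Both costs sum over the edges through \<open>v\<close>. Such an edge meets
  \<open>S\<close> in at least one vertex and \<open>X\<close> in no fewer, so
  \<open>gap_mono\<close> compares the sums term by term.\<close>

lemma peel_cost_mono:
  assumes "v \<in> S" "S \<subseteq> X" "X \<subseteq> V"
  shows "peel_cost E r s S v \<le> peel_cost E r s X v"
  unfolding peel_cost_def
proof (rule sum_mono)
  fix e assume "e \<in> {e \<in> E. v \<in> e}"
  then have e: "e \<in> E" "v \<in> e" by auto
  have "e \<inter> S \<noteq> {}" using e assms by auto
  then have "1 \<le> card (e \<inter> S)" using finite_edge[OF e(1)] by (simp add: Suc_le_eq card_gt_0_iff)
  moreover have "card (e \<inter> S) \<le> card (e \<inter> X)"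
    using finite_edge[OF e(1)] assms by (intro card_mono) auto
  ultimately show "r e (card (e \<inter> S)) - s e (card (e \<inter> S) - 1)
      \<le> r e (card (e \<inter> X)) - s e (card (e \<inter> X) - 1)"
    by (intro gap_mono e card_edge_Int_le)
qed

text \<open>Deleting \<open>v\<close> only affects edges through \<open>v\<close>, whose
  intersection with \<open>S\<close> shrinks by exactly one. Replacing the remaining reward by its
  surrogate can only increase the difference.\<close>

lemma marginal_loss_le_peel_cost:
  assumes "v \<in> S"
  shows "total_reward E r S - total_reward E r (S - {v}) \<le> peel_cost E r s S v"
proof -
  have "total_reward E r S - total_reward E r (S - {v})
      = (\<Sum>e\<in>E. r e (card (e \<inter> S)) - r e (card (e \<inter> (S - {v}))))"
    unfolding total_reward_def by (simp add: sum_subtractf)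
  also have "\<dots> = (\<Sum>e\<in>{e \<in> E. v \<in> e}. r e (card (e \<inter> S)) - r e (card (e \<inter> (S - {v}))))"
  proof (rule sum.mono_neutral_right)
    show "\<forall>e\<in>E - {e \<in> E. v \<in> e}. r e (card (e \<inter> S)) - r e (card (e \<inter> (S - {v}))) = 0"
    proof
      fix e assume "e \<in> E - {e \<in> E. v \<in> e}"
      then have "e \<inter> (S - {v}) = e \<inter> S" by auto
      then show "r e (card (e \<inter> S)) - r e (card (e \<inter> (S - {v}))) = 0" by simp
    qed
  qed (auto simp: finite_E)
  also have "\<dots> \<le> peel_cost E r s S v"
    unfolding peel_cost_def
  proof (rule sum_mono)
    fix e assume "e \<in> {e \<in> E. v \<in> e}"
    then have e: "e \<in> E" "v \<in> e" by auto
    have "e \<inter> (S - {v}) = e \<inter> S - {v}" by auto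
    then have "card (e \<inter> (S - {v})) = card (e \<inter> S) - 1"
      using e assms finite_edge by simp
    then show "r e (card (e \<inter> S)) - r e (card (e \<inter> (S - {v})))
        \<le> r e (card (e \<inter> S)) - s e (card (e \<inter> S) - 1)"
      using surrogate_le[OF e(1) card_edge_Int_le[OF e(1)], of "S - {v}"] by simp
  qed
  finally show ?thesis .
qed

text \<open>With d the density of \<open>S\<close>, the reward of \<open>S\<close> is d |S|, while
  that of \<open>S - {v}\<close> is at most d (|S| - 1) by optimality.\<close>

lemma densest_le_marginal_loss:
  assumes "S \<subseteq> V" "v \<in> S"
    and opt: "\<And>T. T \<noteq> {} \<Longrightarrow> T \<subseteq> V \<Longrightarrow> density E r T \<le> density E r S"
  shows "density E r S \<le> total_reward E r S - total_reward E r (S - {v})"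
proof -
  have fin: "finite S" using assms(1) finite_V by (rule finite_subset)
  have "total_reward E r (S - {v}) \<le> density E r S * real (card (S - {v}))"
  proof (cases "S - {v} = {}")
    \<comment> \<open>\<open>opt\<close> says nothing about the empty set; here both sides are
      0.\<close>
    case True
    show ?thesis unfolding True by (simp add: total_reward_empty)
  next
    case False
    have sub: "S - {v} \<subseteq> V" using assms(1) by auto
    show ?thesis
      unfolding total_reward_eq_density[OF sub]
      by (intro mult_right_mono opt False sub) simp
  qed
  moreover have "card S = Suc (card (S - {v}))" using card_Suc_Diff1[OF fin assms(2)] by simp
  ultimately show ?thesis
    using total_reward_eq_density[OF assms(1)] by (simp add: algebra_simps)
qed

text \<open>Double counting: after swapping the sums, edge \<open>e\<close> occurs once for each
  vertex of \<open>e \<inter> X\<close>.\<close>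

lemma sum_peel_cost_le:
  assumes "X \<subseteq> V"
  shows "(\<Sum>u\<in>X. peel_cost E r s X u) \<le> real (max_edge_size E) * total_reward E r X"
proof -
  have finX: "finite X" using assms finite_V by (rule finite_subset)
  let ?g = "\<lambda>e. r e (card (e \<inter> X)) - s e (card (e \<inter> X) - 1)"
  have "(\<Sum>u\<in>X. peel_cost E r s X u) = (\<Sum>e\<in>E. \<Sum>u\<in>{u \<in> X. u \<in> e}. ?g e)"
    unfolding peel_cost_def by (rule sum.swap_restrict[OF finX finite_E])
  also have "\<dots> \<le> (\<Sum>e\<in>E. real (max_edge_size E) * r e (card (e \<inter> X)))"
  proof (rule sum_mono)
    fix e assume e: "e \<in> E"
    have "{u \<in> X. u \<in> e} = e \<inter> X" by auto
    then have "(\<Sum>u\<in>{u \<in> X. u \<in> e}. ?g e) = real (card (e \<inter> X)) * ?g e" by simp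
    also have "\<dots> \<le> real (card (e \<inter> X)) * r e (card (e \<inter> X))"
    proof (rule mult_left_mono)
      \<comment> \<open>If \<open>e \<inter> X\<close> is empty, the index truncates to 0, where the
        surrogate is still nonnegative.\<close>
      have "card (e \<inter> X) - 1 \<le> card e" using card_edge_Int_le[OF e, of X] by simp
      then show "?g e \<le> r e (card (e \<inter> X))" using surrogate_nonneg[OF e] by simp
    qed simp
    also have "\<dots> \<le> real (max_edge_size E) * r e (card (e \<inter> X))"
      using card_edge_Int_le[OF e, of X] card_edge_le_max[OF e]
      by (intro mult_right_mono reward_nonneg e) auto
    finally show "(\<Sum>u\<in>{u \<in> X. u \<in> e}. ?g e) \<le> real (max_edge_size E) * r e (card (e \<inter> X))" .
  qed
  also have "\<dots> = real (max_edge_size E) * total_reward E r X"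
    unfolding total_reward_def by (simp add: sum_distrib_left)
  finally show ?thesis .
qed

lemma densest_le_max_edge_size_times_density:
  assumes "S \<subseteq> X" "X \<subseteq> V" "v \<in> S"
    and min: "is_arg_min (peel_cost E r s X) (\<lambda>u. u \<in> X) v"
    and opt: "\<And>T. T \<noteq> {} \<Longrightarrow> T \<subseteq> V \<Longrightarrow> density E r T \<le> density E r S"
  shows "density E r S \<le> real (max_edge_size E) * density E r X"
proof -
  have "S \<subseteq> V" using assms by auto
  have "density E r S \<le> peel_cost E r s S v"
    using densest_le_marginal_loss[OF \<open>S \<subseteq> V\<close> \<open>v \<in> S\<close> opt] marginal_loss_le_peel_cost[OF \<open>v \<in> S\<close>]
    by linarith
  also have "\<dots> \<le> peel_cost E r s X v" using assms by (intro peel_cost_mono)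
  \<comment> \<open>The bound passes from \<open>v\<close> to every \<open>u\<close> in
    \<open>X\<close> because \<open>v\<close> minimizes the cost.\<close>
  finally have cost: "density E r S \<le> peel_cost E r s X u" if "u \<in> X" for u
    using min that unfolding is_arg_min_linorder by force
  have "real (card X) * density E r S \<le> (\<Sum>u\<in>X. peel_cost E r s X u)"
    using sum_bounded_below[of X "density E r S" "peel_cost E r s X"] cost by simp
  also have "\<dots> \<le> real (max_edge_size E) * total_reward E r X"
    using \<open>X \<subseteq> V\<close> by (rule sum_peel_cost_le)
  finally have "real (card X) * density E r S \<le> real (max_edge_size E) * total_reward E r X" .
  moreover have "card X > 0"
    using assms(1-3) finite_V by (auto simp: card_gt_0_iff intro: finite_subset)
  ultimately show ?thesis unfolding density_def[of E r X] by (simp add: field_simps)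
qed

section \<open>Runs of the loop\<close>

lemma peel_density_mono:
  assumes "peel E r s X Y Z"
  shows "density E r Y \<le> density E r Z"
  using assms by induction (auto split: if_splits)

lemma peel_output_subset:
  assumes "peel E r s X Y Z" "X \<subseteq> V" "Y \<noteq> {}" "Y \<subseteq> V"
  shows "Z \<noteq> {} \<and> Z \<subseteq> V"
  using assms
proof induction
  case (step X v X' Y' Y Z)
  then show ?case by (auto split: if_splits)
qed simp

lemma ex_peel:
  assumes "finite X"
  shows "\<exists>Z. peel E r s X Y Z"
  using assms
proof (induction X arbitrary: Y rule: finite_psubset_induct)
  case (psubset X)
  show ?case
  proof (cases "X = {}")
    case True
    then show ?thesis by (auto intro: peel.stop)
  next
    case False
    then obtain v where v: "is_arg_min (peel_cost E r s X) (\<lambda>u. u \<in> X) v"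
      using ex_is_arg_min_if_finite[OF \<open>finite X\<close>] by blast
    then have "X - {v} \<subset> X" by (auto simp: is_arg_min_def)
    then obtain Z where "peel E r s (X - {v})
        (if X - {v} \<noteq> {} \<and> density E r (X - {v}) \<ge> density E r Y then X - {v} else Y) Z"
      using psubset.IH by blast
    then show ?thesis using peel.step[OF v refl refl] by blast
  qed
qed

text \<open>Induction on the run with two invariants: no vertex of \<open>S\<close> has been peeled
  yet, and the incumbent is at least as dense as the current set.\<close>

lemma peel_approx:
  assumes "peel E r s X Y Z" "X \<subseteq> V" "S \<noteq> {}" "S \<subseteq> X"
    and "density E r X \<le> density E r Y"
    and opt: "\<And>T. T \<noteq> {} \<Longrightarrow> T \<subseteq> V \<Longrightarrow> density E r T \<le> density E r S"
  shows "density E r S \<le> real (max_edge_size E) * density E r Z"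
  using assms(1-5)
proof induction
  \<comment> \<open>Impossible: the nonempty \<open>S\<close> would lie in the empty current
    set.\<close>
  case (stop Y)
  then show ?case by simp
next
  case (step X v X' Y' Y Z)
  show ?case
  proof (cases "v \<in> S")
    case True
    have "density E r S \<le> real (max_edge_size E) * density E r X"
      using step.hyps(1) step.prems True opt
      by (intro densest_le_max_edge_size_times_density) auto
    \<comment> \<open>The incumbent \<open>Y\<close> is at least as dense as \<open>X\<close>, and
      later replacements never lower its density.\<close>
    moreover have "density E r X \<le> density E r Z"
      using peel_density_mono[OF peel.step[OF step.hyps]] step.prems by linarith
    then have "real (max_edge_size E) * density E r X \<le> real (max_edge_size E) * density E r Z"
      by (rule mult_left_mono) simp
    ultimately show ?thesis by linarith
  next
    case False
    then have "S \<subseteq> X'" "X' \<subseteq> V" "X' \<noteq> {}" using step by auto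
    \<comment> \<open>As \<open>X'\<close> contains \<open>S\<close> it is nonempty, so it fails to
      replace \<open>Y\<close> only by being less dense.\<close>
    moreover have "density E r X' \<le> density E r Y'" using step.hyps(3) \<open>X' \<noteq> {}\<close> by simp
    ultimately show ?thesis using step.IH step.prems by blast
  qed
qed

end

theorem theorem4:
  fixes V :: "'v set" and E :: "'v set set"
    and r s :: "'v set \<Rightarrow> nat \<Rightarrow> real" and k :: nat
  assumes "finite V" and "V \<noteq> {}"
    and "\<And>e. e \<in> E \<Longrightarrow> e \<subseteq> V"
    and "k = max_edge_size E"
    and "\<And>e i. e \<in> E \<Longrightarrow> i \<le> card e \<Longrightarrow> 0 \<le> r e i"
    and "\<And>e. e \<in> E \<Longrightarrow> mono_on {0..card e} (r e)"
    and "\<And>e. e \<in> E \<Longrightarrow> r e 0 = 0"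
    and "\<And>e i. e \<in> E \<Longrightarrow> i \<le> card e \<Longrightarrow> 0 \<le> s e i \<and> s e i \<le> r e i"
    and "\<And>e i. e \<in> E \<Longrightarrow> 1 \<le> i \<Longrightarrow> i + 1 \<le> card e \<Longrightarrow>
           r e i - s e (i - 1) \<le> r e (i + 1) - s e i"
  shows "(\<exists>Y. peeling_returns V E r s Y) \<and>
    (\<forall>Y. peeling_returns V E r s Y \<longrightarrow>
       Y \<noteq> {} \<and> Y \<subseteq> V \<and>
       density E r Y \<ge> 1 / real k * Max (density E r ` {S. S \<noteq> {} \<and> S \<subseteq> V}))"
proof -
  interpret surrogate_hypergraph V E r s
    using assms(1,3,7-9) by unfold_locales auto
  let ?A = "{S. S \<noteq> {} \<and> S \<subseteq> V}"
  have A: "finite (density E r ` ?A)" "density E r ` ?A \<noteq> {}"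
    using finite_V \<open>V \<noteq> {}\<close> by auto
  from Max_in[OF A] obtain S
    where S: "S \<noteq> {}" "S \<subseteq> V" "Max (density E r ` ?A) = density E r S" by auto
  have opt: "density E r T \<le> density E r S" if "T \<noteq> {}" "T \<subseteq> V" for T
    using Max_ge[OF A(1), of "density E r T"] that S(3) by auto
  show ?thesis
  proof (intro conjI allI impI)
    show "\<exists>Y. peeling_returns V E r s Y"
      unfolding peeling_returns_def using ex_peel finite_V .
  next
    fix Y assume "peeling_returns V E r s Y"
    then have Y: "peel E r s V V Y" unfolding peeling_returns_def .
    show "Y \<noteq> {}" "Y \<subseteq> V"
      using peel_output_subset[OF Y] \<open>V \<noteq> {}\<close> by auto
    \<comment> \<open>The run starts with both sets equal to \<open>V\<close>, so both invariants
      hold at entry.\<close>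
    have "density E r S \<le> real k * density E r Y"
      using peel_approx[OF Y _ S(1,2) _ opt] \<open>k = max_edge_size E\<close> by simp
    \<comment> \<open>For \<open>k = 0\<close> the factor \<open>1 / real k\<close> is 0 in HOL, and
      nonnegativity of the density suffices.\<close>
    then show "density E r Y \<ge> 1 / real k * Max (density E r ` ?A)"
      using density_nonneg[of Y] S(3) by (cases "k = 0") (auto simp: field_simps)
  qed
qed

end
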